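(* Let $n\ge2$ and let $f:\mathbb{S}^n\to\mathbb{R}$ be convex and $\beta$-smooth ($\beta>0$), with $f^*=\min_{\mathbf{X}\in\mathcal{S}_n}f(\mathbf{X})$. Suppose that there exists a minimizer $\mathbf{X}^*$ of $f$ over $\mathcal{S}_n$ with $\lambda_{n-1}(\nabla f(\mathbf{X}^* ))-\lambda_n(\nabla f(\mathbf{X}^* ))>0$, and let $\hat\delta\in(0,\lambda_{n-1}(\nabla f(\mathbf{X}^* ))-\lambda_n(\nabla f(\mathbf{X}^* ))]$. Then the iterates $\{\mathbf{X}_t\}_{t\ge1}$ of the regularized Frank-Wolfe algorithm described in the context, run with parameters $\beta$ and $\hat\delta$, satisfy $$\forall t\ge1:\quad f(\mathbf{X}_{t+1})-f^*\le\left(1-\min\Big\{\frac12,\frac{\hat\delta}{4\beta}\Big\}\right)\left(f(\mathbf{X}_t)-f^*\right).$$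
   Context: $\mathbb{S}^n$ is the space of real symmetric $n\times n$ matrices with the trace inner product $\langle\cdot,\cdot\rangle$ and Frobenius norm $\Vert\cdot\Vert_F$. $\mathcal{S}_n=\{\mathbf{X}\in\mathbb{S}^n : \mathbf{X}\succeq 0,\ \mathrm{Tr}(\mathbf{X})=1\}$. Eigenvalues of a symmetric matrix are ordered $\lambda_1\ge\dots\ge\lambda_n$. $f$ is $\beta$-smooth if it is differentiable and $\Vert\nabla f(\mathbf{X})-\nabla f(\mathbf{Y})\Vert_F\le\beta\Vert\mathbf{X}-\mathbf{Y}\Vert_F$ for all $\mathbf{X},\mathbf{Y}$. Regularized Frank-Wolfe algorithm with inputs $\beta,\hat\delta$: $\mathbf{X}_1$ is an arbitrary point of $\mathcal{S}_n$; $\eta=\min\{1,\frac{\hat\delta}{2\beta}\}$. For $t=1,2,\dots$: let $\mathbf{v}_t\in\arg\min_{\mathbf{v}\in\mathbb{R}^n,\Vert\mathbf{v}\Vert_2=1}\langle\mathbf{v}\mathbf{v}^\top,\nabla f(\mathbf{X}_t)\rangle+\frac{\eta\beta}{2}\Vert\mathbf{v}\mathbf{v}^\top-\mathbf{X}_t\Vert_F^2$ (computed exactly), and set $\mathbf{X}_{t+1}=(1-\eta)\mathbf{X}_t+\eta\mathbf{v}_t\mathbf{v}_t^\top$. *)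

theory Defs
  imports "HOL-Analysis.Analysis" "HOL-Computational_Algebra.Computational_Algebra"
begin

definition sym_matrices :: "(real^'n^'n) set" where
  "sym_matrices = {A. transpose A = A}"

definition pos_semidef :: "real^'n^'n \<Rightarrow> bool" where
  "pos_semidef A \<longleftrightarrow> (\<forall>x. 0 \<le> x \<bullet> (A *v x))"

definition spectrahedron :: "(real^'n^'n) set" where
  "spectrahedron = {X \<in> sym_matrices. pos_semidef X \<and> trace X = 1}"

definition outer :: "real^'n \<Rightarrow> real^'n^'n" where
  "outer v = (\<chi> i j. v $ i * v $ j)"

lemma outer_eq: "outer v = (columnvector v :: real^1^'n) ** rowvector v"
  by (simp add: outer_def matrix_matrix_mult_def columnvector_def rowvector_def vec_eq_iff)

(* On real^'n^'n the library's inner product and norm are the trace inner product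
   and the Frobenius norm. *)

lemma inner_eq_trace:
  fixes A B :: "real^'n^'n"
  shows "A \<bullet> B = trace (transpose A ** B)"
proof -
  have "trace (transpose A ** B) = (\<Sum>j\<in>UNIV. \<Sum>i\<in>UNIV. A $ i $ j * B $ i $ j)"
    by (simp add: trace_def matrix_matrix_mult_def transpose_def)
  also have "\<dots> = A \<bullet> B"
    unfolding inner_vec_def inner_real_def by (rule sum.swap)
  finally show ?thesis ..
qed

lemma norm_eq_frobenius:
  fixes A :: "real^'n^'n"
  shows "norm A = sqrt (\<Sum>i\<in>UNIV. \<Sum>j\<in>UNIV. (A $ i $ j)\<^sup>2)"
  by (simp add: norm_eq_sqrt_inner inner_vec_def power2_eq_square)

definition charpoly :: "real^'n^'n \<Rightarrow> real poly" where
  "charpoly A = det (mat [:0, 1:] - map_matrix (\<lambda>a. [:a:]) A)"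

(* eigval k A is the k-th largest eigenvalue of A, counted with multiplicity, for
   1 \<le> k \<le> CARD('n); a real symmetric matrix has exactly CARD('n) real eigenvalues,
   so the list below then has that length. *)
definition eigval :: "nat \<Rightarrow> real^'n^'n \<Rightarrow> real" where
  "eigval k A = rev (sorted_list_of_multiset (proots (charpoly A))) ! (k - 1)"

(* The gradient is taken in the Euclidean space of symmetric matrices, so f matters only on
   that subspace and the gradient is itself symmetric. *)
definition has_sym_gradient ::
  "(real^'n^'n \<Rightarrow> real) \<Rightarrow> real^'n^'n \<Rightarrow> real^'n^'n \<Rightarrow> bool" where
  "has_sym_gradient f G X \<longleftrightarrow>
     G \<in> sym_matrices \<and> (f has_derivative (\<lambda>H. G \<bullet> H)) (at X within sym_matrices)"

definition sym_gradient :: "(real^'n^'n \<Rightarrow> real) \<Rightarrow> real^'n^'n \<Rightarrow> real^'n^'n" where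
  "sym_gradient f X = (THE G. has_sym_gradient f G X)"

lemma has_sym_gradient_unique:
  assumes X: "X \<in> sym_matrices" and G: "has_sym_gradient f G X" and G': "has_sym_gradient f G' X"
  shows "G = G'"
proof -
  define D where "D = G - G'"
  have sym: "X + t *\<^sub>R D \<in> sym_matrices" for t
    using X G G'
    by (auto simp: D_def has_sym_gradient_def sym_matrices_def transpose_def vec_eq_iff)
  have path: "((\<lambda>t. X + t *\<^sub>R D) has_derivative (\<lambda>h. h *\<^sub>R D)) (at (0::real))"
    by (auto intro!: derivative_eq_intros)
  have "((\<lambda>Y. f Y - f Y) has_derivative (\<lambda>H. G \<bullet> H - G' \<bullet> H)) (at X within sym_matrices)"
    using G G' unfolding has_sym_gradient_def by (blast intro: has_derivative_diff)
  then have "((\<lambda>_. 0) has_derivative (\<lambda>H. D \<bullet> H)) (at X within sym_matrices)"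
    by (simp add: D_def inner_diff_left)
  then have "((\<lambda>_. 0) has_derivative (\<lambda>H. D \<bullet> H))
      (at (X + 0 *\<^sub>R D) within range (\<lambda>t. X + t *\<^sub>R D))"
    using sym by (auto intro: has_derivative_subset)
  from has_derivative_in_compose[OF path this]
  have "((\<lambda>_. 0::real) has_derivative (\<lambda>h. D \<bullet> (h *\<^sub>R D))) (at (0::real))"
    by simp
  then have "(\<lambda>h::real. D \<bullet> (h *\<^sub>R D)) = (\<lambda>h. 0)"
    by (rule has_derivative_unique) simp
  then have "D \<bullet> (1 *\<^sub>R D) = 0"
    by meson
  then show ?thesis
    by (simp add: D_def)
qed

lemma sym_gradient_eqI:
  assumes "X \<in> sym_matrices" "has_sym_gradient f G X"
  shows "sym_gradient f X = G"
  unfolding sym_gradient_def using assms has_sym_gradient_unique by blast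

definition smooth_on_sym :: "real \<Rightarrow> (real^'n^'n \<Rightarrow> real) \<Rightarrow> bool" where
  "smooth_on_sym \<beta> f \<longleftrightarrow>
     f differentiable_on sym_matrices \<and>
     (\<forall>X\<in>sym_matrices. \<forall>Y\<in>sym_matrices.
        norm (sym_gradient f X - sym_gradient f Y) \<le> \<beta> * norm (X - Y))"

definition step_size :: "real \<Rightarrow> real \<Rightarrow> real" where
  "step_size \<beta> \<delta> = min 1 (\<delta> / (2 * \<beta>))"

(* X and v are indexed from 1; their values at 0 are irrelevant. *)
definition regularized_FW ::
  "(real^'n^'n \<Rightarrow> real) \<Rightarrow> real \<Rightarrow> real \<Rightarrow> (nat \<Rightarrow> real^'n^'n) \<Rightarrow> (nat \<Rightarrow> real^'n) \<Rightarrow> bool" where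
  "regularized_FW f \<beta> \<delta> X v \<longleftrightarrow>
     (let \<eta> = step_size \<beta> \<delta> in
       X 1 \<in> spectrahedron \<and>
       (\<forall>t\<ge>1.
          is_arg_min
            (\<lambda>w. outer w \<bullet> sym_gradient f (X t) + \<eta> * \<beta> / 2 * (norm (outer w - X t))\<^sup>2)
            (\<lambda>w. norm w = 1) (v t) \<and>
          X (t + 1) = (1 - \<eta>) *\<^sub>R X t + \<eta> *\<^sub>R outer (v t)))"

end

theory Submission
  imports Defs
begin

text \<open>
  The eigengap \<open>\<delta>\<close> of the gradient at the minimiser \<open>X*\<close> forces \<open>X* = u u\<^sup>T\<close> for a bottom
  eigenvector \<open>u\<close>, and by convexity it yields quadratic growth
  \<open>\<delta>/2 \<parallel>X - X*\<parallel>\<^sup>2 \<le> f X - f X*\<close> on the spectrahedron.  As \<open>X*\<close> has rank one, \<open>u\<close> competes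
  with \<open>v t\<close> in the regularized subproblem, so the descent lemma bounds \<open>f (X (t + 1))\<close> by
  the model value at \<open>X*\<close>.  There, by quadratic growth and \<open>\<eta> \<beta> \<le> \<delta>/2\<close>, the quadratic
  term is at most half of the optimality gap.
\<close>

section \<open>The spectral theorem\<close>

text \<open>Induction on the dimension of \<open>S\<close>: a maximiser \<open>u\<close> of the
  quadratic form on the unit sphere of \<open>S\<close> is an eigenvector, and self-adjointness
  makes the orthogonal complement of \<open>u\<close> in \<open>S\<close> invariant again. An
  arbitrary invariant subspace is allowed so that the induction applies to that complement.\<close>

lemma selfadjoint_eigenbasis:
  fixes f :: "'a::euclidean_space \<Rightarrow> 'a"
  assumes lin: "linear f" and sa: "\<And>x y. f x \<bullet> y = x \<bullet> f y"
    and "subspace S" and "f ` S \<subseteq> S"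
  shows "\<exists>B. pairwise orthogonal B \<and> (\<forall>b\<in>B. norm b = 1 \<and> (\<exists>c. f b = c *\<^sub>R b)) \<and> span B = S"
  using assms(3,4)
proof (induction "dim S" arbitrary: S rule: less_induct)
  case less
  show ?case
  proof (cases "S \<subseteq> {0}")
    case True
    then have "span {} = S"
      using subspace_0[OF less.prems(1)] by auto
    then show ?thesis by (intro exI[of _ "{}"]) (auto simp: pairwise_def)
  next
    case False
    then obtain z where z: "z \<in> S" "z \<noteq> 0" by blast
    have "compact (sphere 0 1 \<inter> S)"
      by (intro compact_Int_closed compact_sphere closed_subspace less.prems(1))
    moreover have "(1 / norm z) *\<^sub>R z \<in> sphere 0 1 \<inter> S"
      using z less.prems(1) by (simp add: subspace_scale)
    moreover have "continuous_on (sphere 0 1 \<inter> S) (\<lambda>x. x \<bullet> f x)"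
      using linear_continuous_on[OF linear_conv_bounded_linear[THEN iffD1, OF lin]]
      by (intro continuous_intros) auto
    ultimately obtain u where u: "u \<in> S" "norm u = 1"
      and max: "\<And>x. x \<in> S \<Longrightarrow> norm x = 1 \<Longrightarrow> x \<bullet> f x \<le> u \<bullet> f u"
      using continuous_attains_sup[of "sphere 0 1 \<inter> S" "\<lambda>x. x \<bullet> f x"] by force
    define c where "c = u \<bullet> f u"
    have uu: "u \<bullet> u = 1" using u(2) by (simp add: dot_square_norm)
    \<comment> \<open>Maximality on the sphere extends to all of \<open>S\<close> because both sides
      are homogeneous of degree two.\<close>
    have q: "x \<bullet> f x \<le> c * (x \<bullet> x)" if "x \<in> S" for x
    proof (cases "x = 0")
      case True
      then show ?thesis by simp
    next
      case False
      have "((1 / norm x) *\<^sub>R x) \<bullet> f ((1 / norm x) *\<^sub>R x) \<le> c"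
        unfolding c_def using False that less.prems(1) by (intro max) (auto simp: subspace_scale)
      then have "(x \<bullet> f x) / (norm x)\<^sup>2 \<le> c"
        by (simp add: linear_scale[OF lin] power2_eq_square)
      then show ?thesis using False by (simp add: dot_square_norm field_simps)
    qed
    define w where "w = f u - c *\<^sub>R u"
    have wS: "w \<in> S"
      unfolding w_def using less.prems u(1) by (auto intro!: subspace_diff subspace_scale)
    \<comment> \<open>Perturbing the maximiser by \<open>t w\<close> changes the form to first order by \<open>2 t (w \<bullet> w)\<close>.\<close>
    have pert: "2 * t * (w \<bullet> w) \<le> t\<^sup>2 * (c * (w \<bullet> w) - w \<bullet> f w)" for t :: real
    proof -
      have "u + t *\<^sub>R w \<in> S"
        using u(1) wS less.prems(1) by (simp add: subspace_add subspace_scale)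
      from q[OF this] have "c + 2 * t * (w \<bullet> f u) + t\<^sup>2 * (w \<bullet> f w)
          \<le> c * (1 + 2 * t * (w \<bullet> u) + t\<^sup>2 * (w \<bullet> w))"
        using sa[of u w] uu
        by (simp add: linear_add[OF lin] linear_scale[OF lin] algebra_simps c_def
            inner_commute power2_eq_square)
      moreover have "w \<bullet> f u = w \<bullet> w + c * (w \<bullet> u)"
        by (simp add: w_def inner_diff_right)
      ultimately show ?thesis by (simp only:) (simp add: algebra_simps)
    qed
    have "w = 0"
    proof (rule ccontr)
      assume "w \<noteq> 0"
      then have a: "w \<bullet> w > 0" by simp
      define b where "b = c * (w \<bullet> w) - w \<bullet> f w"
      \<comment> \<open>This makes \<open>t * (\<bar>b\<bar> + 1)\<close> equal to
        \<open>w \<bullet> w\<close>, so the second-order term is too small for \<open>pert\<close>;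
        the \<open>+ 1\<close> covers \<open>b = 0\<close>.\<close>
      define t where "t = (w \<bullet> w) / (\<bar>b\<bar> + 1)"
      have t: "t > 0" using a by (simp add: t_def)
      from pert[of t] have "2 * (w \<bullet> w) \<le> t * b"
        using t by (simp add: b_def power2_eq_square)
      also have "\<dots> \<le> t * (\<bar>b\<bar> + 1)" using t by (intro mult_left_mono) auto
      also have "\<dots> = w \<bullet> w" unfolding t_def by (simp add: field_simps)
      finally show False using a by simp
    qed
    then have fu: "f u = c *\<^sub>R u" by (simp add: w_def)
    define T where "T = {x \<in> S. x \<bullet> u = 0}"
    have "subspace T"
      using less.prems(1) unfolding T_def
      by (auto simp: subspace_def inner_add_left)
    moreover have "f ` T \<subseteq> T"
      using less.prems(2) unfolding T_def by (auto simp: sa fu)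
    moreover have "dim T < dim S"
    proof (rule dim_psubset)
      have "u \<notin> T" using uu by (simp add: T_def)
      moreover have "T \<subseteq> S" by (auto simp: T_def)
      ultimately have "T \<subset> S" using u(1) by blast
      then show "span T \<subset> span S"
        using \<open>subspace T\<close> less.prems(1) by (metis span_eq_iff)
    qed
    ultimately obtain B where B: "pairwise orthogonal B"
      "\<forall>b\<in>B. norm b = 1 \<and> (\<exists>c. f b = c *\<^sub>R b)" "span B = T"
      using less.hyps by blast
    have BT: "B \<subseteq> T" using B(3) span_superset by blast
    have "span (insert u B) = S"
    proof
      show "span (insert u B) \<subseteq> S"
        using BT u(1) less.prems(1) by (intro span_minimal) (auto simp: T_def)
      show "S \<subseteq> span (insert u B)"
      proof
        fix x assume "x \<in> S"
        then have "x - (x \<bullet> u) *\<^sub>R u \<in> T"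
          using u(1) less.prems(1) uu
          by (auto simp: T_def inner_diff_left intro!: subspace_diff subspace_scale)
        then show "x \<in> span (insert u B)"
          unfolding span_insert B(3) by blast
      qed
    qed
    moreover have "pairwise orthogonal (insert u B)"
      using B(1) BT by (auto simp: pairwise_insert orthogonal_def T_def inner_commute)
    ultimately show ?thesis
      using B(2) u(2) fu by (intro exI[of _ "insert u B"]) auto
  qed
qed

lemma inner_outer: "(A::real^'n^'n) \<bullet> outer x = x \<bullet> (A *v x)"
  by (simp add: inner_vec_def outer_def matrix_vector_mult_def sum_distrib_left algebra_simps)

lemma symmetric_selfadjoint:
  assumes "(A::real^'n^'n) \<in> sym_matrices"
  shows "(A *v x) \<bullet> y = x \<bullet> (A *v y)"
  using assms dot_lmul_matrix[of x A y]
  by (simp add: sym_matrices_def flip: vector_transpose_matrix)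

text \<open>With the eigenvectors as columns of \<open>P\<close>, both sums are entrywise readings
  of matrix products: \<open>P ** transpose P = mat 1\<close> and
  \<open>A = (A ** P) ** transpose P\<close>. The resolution of \<open>mat 1\<close> later expresses
  traces in the eigenbasis.\<close>

lemma spectral_decomposition:
  fixes A :: "real^'n^'n"
  assumes "A \<in> sym_matrices"
  obtains p :: "'n \<Rightarrow> real^'n" and d :: "'n \<Rightarrow> real"
  where "\<And>i j. p i \<bullet> p j = (if i = j then 1 else 0)" "\<And>j. A *v p j = d j *\<^sub>R p j"
    "mat 1 = (\<Sum>j\<in>UNIV. outer (p j))" "A = (\<Sum>j\<in>UNIV. d j *\<^sub>R outer (p j))"
proof -
  obtain B where B: "pairwise orthogonal B"
      "\<forall>b\<in>B. norm b = 1 \<and> (\<exists>c. A *v b = c *\<^sub>R b)" "span B = UNIV"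
    using selfadjoint_eigenbasis[of "(*v) A" UNIV] symmetric_selfadjoint[OF assms] by auto
  have "0 \<notin> B" using B(2) by auto
  then have indep: "independent B" using B(1) by (simp add: pairwise_orthogonal_independent)
  then have fin: "finite B" by (rule independent_imp_finite)
  have "card B = CARD('n)"
    using dim_eq_card[of B UNIV] B(3) indep by (simp add: dim_UNIV)
  \<comment> \<open>The basis is indexed by \<open>'n\<close> itself, so that \<open>P\<close> below
    is square.\<close>
  then obtain p where p: "bij_betw p (UNIV::'n set) B"
    using fin by (metis finite bij_betw_iff_card)
  then have pB: "p j \<in> B" for j using bij_betwE by blast
  have orth: "p i \<bullet> p j = (if i = j then 1 else 0)" for i j
    using B(1,2) pB p
    by (auto simp: pairwise_def orthogonal_def bij_betw_def inj_eq dot_square_norm)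
  have "\<forall>j. \<exists>c. A *v p j = c *\<^sub>R p j" using B(2) pB by blast
  then obtain d where d: "\<And>j. A *v p j = d j *\<^sub>R p j" unfolding choice_iff by blast
  define P :: "real^'n^'n" where "P = (\<chi> i j. p j $ i)"
  have "transpose P ** P = mat 1"
    using orth by (simp add: P_def vec_eq_iff matrix_matrix_mult_def transpose_def mat_def inner_vec_def)
  \<comment> \<open>For a square matrix a left inverse is a right inverse: orthonormality becomes
    completeness.\<close>
  then have PP: "P ** transpose P = mat 1"
    by (simp add: matrix_left_right_inverse)
  have "mat 1 = (\<Sum>j\<in>UNIV. outer (p j))"
    unfolding PP[symmetric]
    by (simp add: P_def vec_eq_iff matrix_matrix_mult_def transpose_def outer_def)
  moreover have "A = (\<Sum>j\<in>UNIV. d j *\<^sub>R outer (p j))"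
  proof -
    have AP: "(A ** P) $ i $ j = d j * p j $ i" for i j
      using d[of j] by (simp add: P_def vec_eq_iff matrix_matrix_mult_def matrix_vector_mult_def)
    have PT: "transpose P $ j $ k = p j $ k" for j k
      by (simp add: P_def transpose_def)
    have "A = (A ** P) ** transpose P"
      by (simp add: PP flip: matrix_mul_assoc)
    also have "\<dots> = (\<Sum>j\<in>UNIV. d j *\<^sub>R outer (p j))"
      by (simp add: vec_eq_iff matrix_matrix_mult_def[of "A ** P"] AP PT outer_def mult.assoc)
    finally show ?thesis .
  qed
  ultimately show ?thesis using that orth d by blast
qed

section \<open>Eigenvalues\<close>

text \<open>Embedding reals as constant polynomials respects products, so real matrix identities
  carry over to the polynomial matrices of \<open>charpoly\<close>.\<close>

lemma map_matrix_const_poly_mult: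
  fixes A B :: "real^'n^'n"
  shows "map_matrix (\<lambda>a. [:a:]) (A ** B) = map_matrix (\<lambda>a. [:a:]) A ** map_matrix (\<lambda>a. [:a:]) B"
  by (simp add: vec_eq_iff map_matrix_def matrix_matrix_mult_def poly_eq_iff coeff_sum
      coeff_pCons mult.commute split: nat.split)

lemma matrix_matrix_mult_diff_distrib:
  fixes A B :: "'a::comm_ring_1^'n^'m"
  shows "(A - B) ** (C :: 'a^'k^'n) = A ** C - B ** C"
    and "(D :: 'a^'m^'k) ** (A - B) = D ** A - D ** B"
  by (simp_all add: vec_eq_iff matrix_matrix_mult_def algebra_simps sum_subtractf)

text \<open>\<open>A ** P = P ** E\<close> with \<open>E\<close> diagonal, and the scalar matrix of
  the indeterminate commutes with \<open>P\<close>, so the characteristic determinants of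
  \<open>A\<close> and \<open>E\<close> agree once \<open>det P\<close> is cancelled. This ties
  \<open>eigval\<close>, defined through polynomial roots, to an eigenbasis.\<close>

lemma charpoly_eigenbasis:
  fixes A :: "real^'n^'n" and p :: "'n \<Rightarrow> real^'n"
  assumes orth: "\<And>i j. p i \<bullet> p j = (if i = j then 1 else 0)"
    and d: "\<And>j. A *v p j = d j *\<^sub>R p j"
  shows "charpoly A = (\<Prod>j\<in>UNIV. [:- d j, 1:])"
proof -
  let ?c = "map_matrix (\<lambda>a. [:a:]) :: real^'n^'n \<Rightarrow> real poly^'n^'n"
  let ?x = "mat [:0, 1:] :: real poly^'n^'n"
  define P :: "real^'n^'n" where "P = (\<chi> i j. p j $ i)"
  define E :: "real^'n^'n" where "E = (\<chi> i j. if i = j then d j else 0)"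
  have "transpose P ** P = mat 1"
    using orth by (simp add: P_def vec_eq_iff matrix_matrix_mult_def transpose_def mat_def inner_vec_def)
  then have "?c (transpose P) ** ?c P = ?c (mat 1)"
    by (simp flip: map_matrix_const_poly_mult)
  also have "\<dots> = mat 1" by (auto simp: vec_eq_iff map_matrix_def mat_def one_pCons)
  finally have "det (?c (transpose P)) * det (?c P) = 1" by (metis det_I det_mul)
  then have nz: "det (?c P) \<noteq> 0" by auto
  have "A ** P = P ** E"
    using d by (simp add: P_def E_def vec_eq_iff matrix_matrix_mult_def matrix_vector_mult_def
        if_distrib cong: if_cong)
  then have "?c A ** ?c P = ?c P ** ?c E"
    by (metis map_matrix_const_poly_mult)
  moreover have "?x ** ?c P = ?c P ** ?x"
    by (simp add: vec_eq_iff matrix_matrix_mult_def mat_def if_distrib if_distribR mult.commute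
        cong: if_cong)
  ultimately have "(?x - ?c A) ** ?c P = ?c P ** (?x - ?c E)"
    by (simp add: matrix_matrix_mult_diff_distrib)
  then have "charpoly A * det (?c P) = det (?c P) * det (?x - ?c E)"
    unfolding charpoly_def by (metis det_mul)
  then have "charpoly A = det (?x - ?c E)" using nz by simp
  also have "\<dots> = (\<Prod>j\<in>UNIV. (?x - ?c E) $ j $ j)"
    by (rule det_diagonal) (simp add: mat_def map_matrix_def E_def)
  also have "\<dots> = (\<Prod>j\<in>UNIV. [:- d j, 1:])"
    by (simp add: mat_def map_matrix_def E_def)
  finally show ?thesis .
qed

text \<open>The roots form the multiset of the values \<open>d j\<close>, and \<open>eigval\<close>
  reads its ascending list backwards, so the two smallest eigenvalues are the first two entries
  \<open>a\<close> and \<open>b\<close>.\<close>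

lemma two_smallest_eigenvalues:
  fixes A :: "real^'n^'n" and d :: "'n \<Rightarrow> real"
  assumes n: "CARD('n) \<ge> 2" and ch: "charpoly A = (\<Prod>j\<in>UNIV. [:- d j, 1:])"
  obtains k where "d k = eigval CARD('n) A" "\<And>j. j \<noteq> k \<Longrightarrow> eigval (CARD('n) - 1) A \<le> d j"
proof -
  have "proots (charpoly A) = (\<Sum>j\<in>UNIV. proots [:- d j, 1:])"
    unfolding ch by (rule proots_prod) auto
  also have "\<dots> = (\<Sum>j\<in>UNIV. {#d j#})"
    by (intro sum.cong refl) (use proots_linear_factor in auto)
  also have "\<dots> = image_mset d (mset_set UNIV)"
    by (simp add: sum_unfold_sum_mset)
  finally have pr: "proots (charpoly A) = image_mset d (mset_set UNIV)" .
  define l where "l = sorted_list_of_multiset (proots (charpoly A))"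
  have ml: "mset l = image_mset d (mset_set UNIV)" and sl: "sorted l"
    by (simp_all add: l_def pr)
  have len: "length l = CARD('n)"
    using arg_cong[OF ml, of size] by simp
  then obtain a b r where l: "l = a # b # r"
    using n by (cases l rule: remdups_adj.cases) auto
  have ev: "eigval CARD('n) A = a" "eigval (CARD('n) - 1) A = b"
    using len n unfolding eigval_def l_def[symmetric] by (simp_all add: rev_nth) (simp_all add: l)
  have "a \<in># mset l" by (simp add: l)
  then obtain k where k: "d k = a" unfolding ml by auto
  \<comment> \<open>Dropping the single index \<open>k\<close> removes one copy of \<open>a\<close>
    only, so the remaining values are exactly \<open>b # r\<close> even when
    \<open>a = b\<close>.\<close>
  have "mset_set UNIV = add_mset k (mset_set (UNIV - {k}))"
    by (simp add: mset_set.remove)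
  then have "mset (b # r) = image_mset d (mset_set (UNIV - {k}))"
    using ml k l by simp
  then have "set (b # r) = d ` (UNIV - {k})"
    by (metis finite finite_set_mset_mset_set set_image_mset set_mset_mset)
  moreover have "\<forall>x\<in>set (b # r). b \<le> x" using sl l by auto
  ultimately have "j \<noteq> k \<Longrightarrow> b \<le> d j" for j by auto
  with that k ev show ?thesis by metis
qed

section \<open>The spectrahedron\<close>

lemma norm_outer: "norm (outer v) = (norm v)\<^sup>2"
proof -
  have "(norm (outer v))\<^sup>2 = ((norm v)\<^sup>2)\<^sup>2"
    unfolding power2_norm_eq_inner inner_vec_def outer_def
    by (simp add: power2_eq_square sum_product sum_distrib_left algebra_simps)
  then show ?thesis by (rule power2_eq_imp_eq) auto
qed

lemma outer_in_spectrahedron: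
  assumes "norm v = 1"
  shows "outer v \<in> spectrahedron"
proof -
  have "outer v \<in> sym_matrices"
    by (simp add: sym_matrices_def outer_def transpose_def vec_eq_iff)
  moreover have "x \<bullet> (outer v *v x) = (x \<bullet> v)\<^sup>2" for x
    by (simp add: inner_vec_def outer_def matrix_vector_mult_def power2_eq_square sum_product
        sum_distrib_left algebra_simps)
  moreover have "trace (outer v) = (norm v)\<^sup>2"
    unfolding power2_norm_eq_inner by (simp add: trace_def outer_def inner_vec_def)
  ultimately show ?thesis using assms by (simp add: spectrahedron_def pos_semidef_def)
qed

lemma convex_spectrahedron: "convex (spectrahedron :: (real^'n^'n) set)"
proof (rule convexI)
  fix X Y :: "real^'n^'n" and a b :: real
  assume *: "X \<in> spectrahedron" "Y \<in> spectrahedron" "0 \<le> a" "0 \<le> b" "a + b = 1"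
  have "a *\<^sub>R X + b *\<^sub>R Y \<in> sym_matrices"
    using * by (simp add: spectrahedron_def sym_matrices_def transpose_def vec_eq_iff)
  moreover have "pos_semidef (a *\<^sub>R X + b *\<^sub>R Y)"
    using * by (simp add: spectrahedron_def pos_semidef_def matrix_vector_mult_add_rdistrib
        scaleR_matrix_vector_assoc[symmetric] inner_add_right)
  moreover have "trace (a *\<^sub>R X + b *\<^sub>R Y) = 1"
    using * by (simp add: spectrahedron_def trace_def sum.distrib flip: sum_distrib_left)
  ultimately show "a *\<^sub>R X + b *\<^sub>R Y \<in> spectrahedron" by (simp add: spectrahedron_def)
qed

lemma trace_eq_inner: "trace (X::real^'n^'n) = X \<bullet> mat 1"
  by (simp add: trace_def inner_vec_def mat_def if_distrib cong: if_cong)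

text \<open>The eigenvalues of \<open>X\<close> are nonnegative and sum to one, so each is at most
  one and their squares sum to at most one.\<close>

lemma norm_spectrahedron_le:
  fixes X :: "real^'n^'n"
  assumes "X \<in> spectrahedron"
  shows "norm X \<le> 1"
proof -
  have X: "X \<in> sym_matrices" "pos_semidef X" "trace X = 1"
    using assms by (auto simp: spectrahedron_def)
  obtain p :: "'n \<Rightarrow> real^'n" and d :: "'n \<Rightarrow> real"
    where p: "\<And>i j. p i \<bullet> p j = (if i = j then 1 else 0)" "\<And>j. X *v p j = d j *\<^sub>R p j"
    "mat 1 = (\<Sum>j\<in>UNIV. outer (p j))" "X = (\<Sum>j\<in>UNIV. d j *\<^sub>R outer (p j))"
    using spectral_decomposition[OF X(1)] by blast
  have Xp: "X \<bullet> outer (p j) = d j" for j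
    by (simp add: inner_outer p(1,2))
  have nonneg: "d j \<ge> 0" for j
    using X(2) Xp[of j] by (metis inner_outer pos_semidef_def)
  have tr: "(\<Sum>j\<in>UNIV. d j) = 1"
    using X(3) unfolding trace_eq_inner p(3) by (simp add: inner_sum_right Xp)
  have "X \<bullet> X = (\<Sum>j\<in>UNIV. d j * d j)"
    by (subst (2) p(4)) (simp add: inner_sum_right Xp)
  also have "\<dots> \<le> (\<Sum>j\<in>UNIV. d j)"
  proof (rule sum_mono)
    fix j
    have "d j \<le> (\<Sum>j\<in>UNIV. d j)" by (rule member_le_sum) (auto simp: nonneg)
    then show "d j * d j \<le> d j" using nonneg[of j] tr by (simp add: mult_left_le)
  qed
  finally show ?thesis by (simp add: tr norm_eq_sqrt_inner)
qed

text \<open>Expand the square and bound both norms by one. This converts a bound linear in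
  \<open>X\<close> into one on the squared distance, which is how an eigengap produces quadratic
  growth.\<close>

lemma dist_outer_le:
  assumes "X \<in> spectrahedron" "norm u = 1"
  shows "(norm (X - outer u))\<^sup>2 \<le> 2 * (1 - X \<bullet> outer u)"
proof -
  have "(norm X)\<^sup>2 \<le> 1" using norm_spectrahedron_le[OF assms(1)] by (simp add: power_le_one)
  then show ?thesis
    using assms(2)
    by (simp add: norm_outer power2_norm_eq_inner[symmetric] dot_norm_neg field_simps)
qed

text \<open>In an eigenbasis of \<open>G\<close> the diagonal entries \<open>c j\<close> of
  \<open>X\<close> are probability weights and \<open>G \<bullet> X\<close> is the weighted mean of
  the eigenvalues. The weight \<open>1 - c k\<close> lying off the bottom eigenvector meets
  eigenvalues at least \<open>d k + \<delta>\<close>.\<close>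

lemma eigengap_inner_ge:
  fixes G :: "real^'n^'n"
  assumes n: "CARD('n) \<ge> 2" and G: "G \<in> sym_matrices"
    and gap: "\<delta> \<le> eigval (CARD('n) - 1) G - eigval CARD('n) G"
  obtains u where "norm u = 1"
    "\<And>X. X \<in> spectrahedron \<Longrightarrow> G \<bullet> outer u + \<delta> * (1 - X \<bullet> outer u) \<le> G \<bullet> X"
proof -
  obtain p :: "'n \<Rightarrow> real^'n" and d :: "'n \<Rightarrow> real"
    where p: "\<And>i j. p i \<bullet> p j = (if i = j then 1 else 0)" "\<And>j. G *v p j = d j *\<^sub>R p j"
    "mat 1 = (\<Sum>j\<in>UNIV. outer (p j))" "G = (\<Sum>j\<in>UNIV. d j *\<^sub>R outer (p j))"
    using spectral_decomposition[OF G] by blast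
  obtain k where k: "d k = eigval CARD('n) G"
    "\<And>j. j \<noteq> k \<Longrightarrow> eigval (CARD('n) - 1) G \<le> d j"
    using two_smallest_eigenvalues[OF n charpoly_eigenbasis[OF p(1,2)]] by blast
  have Gk: "G \<bullet> outer (p k) = d k"
    by (simp add: inner_outer p(1,2))
  show ?thesis
  proof (rule that[of "p k"])
    show "norm (p k) = 1" using p(1)[of k k] by (simp add: norm_eq_sqrt_inner)
    fix X :: "real^'n^'n" assume X: "X \<in> spectrahedron"
    define c where "c j = X \<bullet> outer (p j)" for j
    have c0: "c j \<ge> 0" for j
      using X by (simp add: c_def inner_outer spectrahedron_def pos_semidef_def)
    have "X \<bullet> mat 1 = 1" using X by (simp add: spectrahedron_def flip: trace_eq_inner)
    then have "(\<Sum>j\<in>UNIV. c j) = 1"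
      unfolding p(3) by (simp add: inner_sum_right c_def)
    then have c1: "(\<Sum>j\<in>UNIV - {k}. c j) = 1 - c k"
      by (simp add: sum_diff1)
    have "G \<bullet> X = (\<Sum>j\<in>UNIV. d j * c j)"
      unfolding inner_commute[of G] c_def by (subst p(4)) (simp add: inner_sum_right)
    also have "\<dots> = d k * c k + (\<Sum>j\<in>UNIV - {k}. d j * c j)"
      by (simp add: sum.remove)
    also have "\<dots> \<ge> d k * c k + (\<Sum>j\<in>UNIV - {k}. (d k + \<delta>) * c j)"
      using k gap c0 by (intro add_left_mono sum_mono mult_right_mono) (auto, smt (verit))
    also have "(\<Sum>j\<in>UNIV - {k}. (d k + \<delta>) * c j) = (d k + \<delta>) * (1 - c k)"
      by (simp add: c1 flip: sum_distrib_left)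
    finally show "G \<bullet> outer (p k) + \<delta> * (1 - X \<bullet> outer (p k)) \<le> G \<bullet> X"
      by (simp add: Gk c_def[symmetric] algebra_simps)
  qed
qed

section \<open>Convex smooth functions of symmetric matrices\<close>

lemma subspace_sym_matrices: "subspace (sym_matrices :: (real^'n^'n) set)"
  by (auto simp: subspace_def sym_matrices_def transpose_def vec_eq_iff)

lemma inner_transpose:
  fixes A B :: "real^'n^'n"
  shows "transpose A \<bullet> transpose B = A \<bullet> B"
proof -
  have "transpose A \<bullet> transpose B = (\<Sum>i\<in>UNIV. \<Sum>j\<in>UNIV. A $ j $ i * B $ j $ i)"
    by (simp add: inner_vec_def transpose_def)
  also have "\<dots> = A \<bullet> B"
    unfolding inner_vec_def inner_real_def by (rule sum.swap)
  finally show ?thesis .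
qed

text \<open>The vector representing a derivative on the full matrix space need not be symmetric.
  Precomposing with the symmetrisation \<open>s\<close>, which fixes symmetric matrices, leaves
  \<open>f\<close> unchanged there and replaces the representative by its symmetric part.\<close>

lemma has_sym_gradient_sym_gradient:
  fixes f :: "real^'n^'n \<Rightarrow> real"
  assumes "f differentiable_on sym_matrices" "X \<in> sym_matrices"
  shows "has_sym_gradient f (sym_gradient f X) X"
proof -
  obtain F where F: "(f has_derivative F) (at X within sym_matrices)"
    using assms by (auto simp: differentiable_on_def differentiable_def)
  then have linF: "linear F" by (rule has_derivative_linear)
  \<comment> \<open>The Riesz representative of the functional \<open>F\<close>.\<close>
  define G0 where "G0 = adjoint F 1"
  have FG: "F H = G0 \<bullet> H" for H
    using adjoint_works[OF linF, of H 1] by (simp add: G0_def inner_commute)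
  define s where "s A = (1/2) *\<^sub>R (A + transpose A)" for A :: "real^'n^'n"
  have "linear s"
    by (rule linearI) (simp_all add: s_def transpose_def vec_eq_iff algebra_simps)
  then have ds: "(s has_derivative s) (at X within sym_matrices)"
    by (simp add: bounded_linear_imp_has_derivative linear_conv_bounded_linear)
  have sfix: "s A = A" if "A \<in> sym_matrices" for A
    using that by (simp add: s_def sym_matrices_def flip: scaleR_2)
  have ssym: "s A \<in> sym_matrices" for A
    by (simp add: s_def sym_matrices_def transpose_def vec_eq_iff)
  have "(f has_derivative F) (at (s X) within s ` sym_matrices)"
    using F ssym assms(2) by (auto simp: sfix intro: has_derivative_subset)
  from has_derivative_in_compose[OF ds this]
  have "((\<lambda>Y. f (s Y)) has_derivative (\<lambda>H. F (s H))) (at X within sym_matrices)" .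
  then have "(f has_derivative (\<lambda>H. F (s H))) (at X within sym_matrices)"
    by (rule has_derivative_transform[OF assms(2), rotated]) (simp add: sfix)
  \<comment> \<open>Symmetrisation is self-adjoint for the trace inner product, so it moves from
    \<open>H\<close> to \<open>G0\<close>.\<close>
  moreover have "F (s H) = s G0 \<bullet> H" for H
    using inner_transpose[of G0 "transpose H"]
    by (simp add: FG s_def inner_add_left inner_add_right)
  ultimately have "has_sym_gradient f (s G0) X"
    by (simp add: has_sym_gradient_def ssym)
  then show ?thesis using sym_gradient_eqI[OF assms(2)] by metis
qed

lemma has_real_derivative_along_line:
  fixes f :: "real^'n^'n \<Rightarrow> real"
  assumes "f differentiable_on sym_matrices" "X \<in> sym_matrices" "D \<in> sym_matrices"
  shows "((\<lambda>t. f (X + t *\<^sub>R D)) has_real_derivative sym_gradient f (X + t *\<^sub>R D) \<bullet> D) (at t)"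
proof -
  have sym: "X + t *\<^sub>R D \<in> sym_matrices" for t
    using assms(2,3) by (simp add: subspace_add subspace_scale subspace_sym_matrices)
  have path: "((\<lambda>t. X + t *\<^sub>R D) has_derivative (\<lambda>h. h *\<^sub>R D)) (at t)"
    by (auto intro!: derivative_eq_intros)
  have "(f has_derivative (\<lambda>H. sym_gradient f (X + t *\<^sub>R D) \<bullet> H))
      (at (X + t *\<^sub>R D) within range (\<lambda>t. X + t *\<^sub>R D))"
    using has_sym_gradient_sym_gradient[OF assms(1) sym[of t]] sym
    by (auto simp: has_sym_gradient_def intro: has_derivative_subset)
  from has_derivative_in_compose[OF path this] show ?thesis
    by (simp add: has_field_derivative_def mult.commute[of _ "sym_gradient f (X + t *\<^sub>R D) \<bullet> D"])
qed

text \<open>On the line through \<open>X\<close> and \<open>Y\<close> this is the one-variable fact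
  that a convex function lies above its tangent at 0, evaluated at 1.\<close>

lemma convex_gradient_inequality:
  fixes f :: "real^'n^'n \<Rightarrow> real"
  assumes "convex_on sym_matrices f" "f differentiable_on sym_matrices"
    and X: "X \<in> sym_matrices" and Y: "Y \<in> sym_matrices"
  shows "f X + sym_gradient f X \<bullet> (Y - X) \<le> f Y"
proof -
  define D where "D = Y - X"
  have D: "D \<in> sym_matrices"
    using X Y by (simp add: D_def subspace_diff subspace_sym_matrices)
  have sym: "X + t *\<^sub>R D \<in> sym_matrices" for t
    using X D by (simp add: subspace_add subspace_scale subspace_sym_matrices)
  have "convex_on UNIV (\<lambda>t. f (X + t *\<^sub>R D))"
  proof (rule convex_onI)
    fix t x y :: real assume t: "0 < t" "t < 1"
    have "X + ((1 - t) *\<^sub>R x + t *\<^sub>R y) *\<^sub>R D = (1 - t) *\<^sub>R (X + x *\<^sub>R D) + t *\<^sub>R (X + y *\<^sub>R D)"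
      by (simp add: algebra_simps)
    then show "f (X + ((1 - t) *\<^sub>R x + t *\<^sub>R y) *\<^sub>R D)
        \<le> (1 - t) * f (X + x *\<^sub>R D) + t * f (X + y *\<^sub>R D)"
      using convex_onD[OF assms(1), of t "X + x *\<^sub>R D" "X + y *\<^sub>R D"] sym t by simp
  qed simp
  moreover have "((\<lambda>t. f (X + t *\<^sub>R D)) has_real_derivative sym_gradient f X \<bullet> D) (at 0)"
    using has_real_derivative_along_line[OF assms(2) X D, of 0] by simp
  ultimately have "sym_gradient f X \<bullet> D * (1 - 0) \<le> f (X + 1 *\<^sub>R D) - f (X + 0 *\<^sub>R D)"
    by (intro convex_on_imp_above_tangent[where A = UNIV]) auto
  then show ?thesis by (simp add: D_def)
qed

text \<open>The descent lemma. The difference \<open>\<phi>\<close> between \<open>f\<close> and its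
  quadratic model along the segment has nonpositive derivative by Cauchy-Schwarz and the Lipschitz
  bound, so \<open>\<phi> 1 \<le> \<phi> 0\<close>; no integration is involved.\<close>

lemma smooth_upper_bound:
  fixes f :: "real^'n^'n \<Rightarrow> real"
  assumes "smooth_on_sym \<beta> f" and X: "X \<in> sym_matrices" and D: "D \<in> sym_matrices"
  shows "f (X + D) \<le> f X + sym_gradient f X \<bullet> D + \<beta> / 2 * (norm D)\<^sup>2"
proof -
  have diff: "f differentiable_on sym_matrices"
    and lip: "\<And>X Y. X \<in> sym_matrices \<Longrightarrow> Y \<in> sym_matrices \<Longrightarrow>
      norm (sym_gradient f X - sym_gradient f Y) \<le> \<beta> * norm (X - Y)"
    using assms(1) by (auto simp: smooth_on_sym_def)
  have sym: "X + t *\<^sub>R D \<in> sym_matrices" for t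
    using X D by (simp add: subspace_add subspace_scale subspace_sym_matrices)
  define \<phi> where "\<phi> t = f (X + t *\<^sub>R D) - t * (sym_gradient f X \<bullet> D) - t\<^sup>2 * (\<beta> / 2 * (norm D)\<^sup>2)" for t
  have "\<phi> 0 \<ge> \<phi> 1"
  proof (rule DERIV_nonpos_imp_nonincreasing[where f = \<phi>])
    fix t :: real assume t: "0 \<le> t" "t \<le> 1"
    let ?y = "sym_gradient f (X + t *\<^sub>R D) \<bullet> D - sym_gradient f X \<bullet> D - 2 * t * (\<beta> / 2 * (norm D)\<^sup>2)"
    have "(\<phi> has_real_derivative ?y) (at t)"
      unfolding \<phi>_def
      by (rule has_real_derivative_along_line[OF diff X D] derivative_eq_intros refl | simp)+
    moreover have "?y \<le> 0"
    proof -
      have "(sym_gradient f (X + t *\<^sub>R D) - sym_gradient f X) \<bullet> D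
          \<le> norm (sym_gradient f (X + t *\<^sub>R D) - sym_gradient f X) * norm D"
        by (rule norm_cauchy_schwarz)
      also have "\<dots> \<le> (\<beta> * norm (X + t *\<^sub>R D - X)) * norm D"
        by (intro mult_right_mono lip sym X) simp
      also have "\<dots> = t * \<beta> * (norm D)\<^sup>2" using t by (simp add: power2_eq_square)
      finally show ?thesis by (simp add: inner_diff_left)
    qed
    ultimately show "\<exists>y. (\<phi> has_real_derivative y) (at t) \<and> y \<le> 0" by blast
  qed simp
  then show ?thesis by (simp add: \<phi>_def)
qed

text \<open>Otherwise the derivative towards \<open>Y\<close> is negative, and a short step, still
  in \<open>S\<close> by convexity, lowers \<open>f\<close> below its minimum.\<close>

lemma minimizer_first_order:
  fixes f :: "real^'n^'n \<Rightarrow> real"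
  assumes diff: "f differentiable_on sym_matrices" and "convex S" "S \<subseteq> sym_matrices"
    and min: "\<And>Y. Y \<in> S \<Longrightarrow> f X \<le> f Y" and X: "X \<in> S" and Y: "Y \<in> S"
  shows "sym_gradient f X \<bullet> X \<le> sym_gradient f X \<bullet> Y"
proof (rule ccontr)
  assume neg: "\<not> ?thesis"
  have sym: "X \<in> sym_matrices" "Y - X \<in> sym_matrices"
    using assms by (auto intro!: subspace_diff subspace_sym_matrices)
  have "((\<lambda>t. f (X + t *\<^sub>R (Y - X))) has_real_derivative sym_gradient f X \<bullet> (Y - X)) (at 0)"
    using has_real_derivative_along_line[OF diff sym, of 0] by simp
  from DERIV_neg_dec_right[OF this] neg obtain e where e: "e > 0"
    "\<And>h. 0 < h \<Longrightarrow> h < e \<Longrightarrow> f (X + h *\<^sub>R (Y - X)) < f X"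
    by (auto simp: inner_diff_right)
  \<comment> \<open>Halving keeps \<open>h\<close> strictly below \<open>e\<close>; the cap at 1
    keeps the point on the segment from \<open>X\<close> to \<open>Y\<close>.\<close>
  define h where "h = min (e / 2) 1"
  have h: "0 < h" "h < e" "h \<le> 1" using e(1) by (auto simp: h_def)
  have "(1 - h) *\<^sub>R X + h *\<^sub>R Y \<in> S"
    using h X Y \<open>convex S\<close> by (intro convexD) auto
  then have "f X \<le> f (X + h *\<^sub>R (Y - X))"
    using min by (metis (no_types, lifting) add.commute add_diff_eq diff_add_eq scaleR_collapse scaleR_left_diff_distrib scaleR_one scaleR_right_diff_distrib)
  with e(2)[OF h(1,2)] show False by simp
qed

section \<open>Linear convergence\<close>

lemma quadratic_growth:
  fixes f :: "real^'n^'n \<Rightarrow> real"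
  assumes n: "CARD('n) \<ge> 2" and conv: "convex_on sym_matrices f"
    and diff: "f differentiable_on sym_matrices"
    and min: "is_arg_min f (\<lambda>Y. Y \<in> spectrahedron) Xstar"
    and \<delta>: "0 < \<delta>" "\<delta> \<le> eigval (CARD('n) - 1) (sym_gradient f Xstar)
                    - eigval (CARD('n)) (sym_gradient f Xstar)"
  obtains u where "norm u = 1" "Xstar = outer u"
    "\<And>X. X \<in> spectrahedron \<Longrightarrow> \<delta> / 2 * (norm (X - Xstar))\<^sup>2 \<le> f X - f Xstar"
proof -
  let ?G = "sym_gradient f Xstar"
  have Xs: "Xstar \<in> spectrahedron" and minle: "\<And>Y. Y \<in> spectrahedron \<Longrightarrow> f Xstar \<le> f Y"
    using min by (auto simp: is_arg_min_linorder)
  have sym: "spectrahedron \<subseteq> (sym_matrices :: (real^'n^'n) set)"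
    by (auto simp: spectrahedron_def)
  have "?G \<in> sym_matrices"
    using has_sym_gradient_sym_gradient[OF diff, of Xstar] Xs sym
    by (auto simp: has_sym_gradient_def)
  from eigengap_inner_ge[OF n this \<delta>(2)] obtain u where u: "norm u = 1"
    and gap: "\<And>X. X \<in> spectrahedron \<Longrightarrow> ?G \<bullet> outer u + \<delta> * (1 - X \<bullet> outer u) \<le> ?G \<bullet> X"
    by blast
  have opt: "?G \<bullet> Xstar \<le> ?G \<bullet> Y" if "Y \<in> spectrahedron" for Y
    by (rule minimizer_first_order[OF diff convex_spectrahedron sym minle Xs that])
  \<comment> \<open>The gap inequality at \<open>Xstar\<close> and first-order optimality tested
    against \<open>outer u\<close> squeeze the off-\<open>u\<close> weight of \<open>Xstar\<close>
    to zero.\<close>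
  have "\<delta> * (1 - Xstar \<bullet> outer u) \<le> 0"
    using gap[OF Xs] opt[OF outer_in_spectrahedron[OF u]] by simp
  then have "1 - Xstar \<bullet> outer u \<le> 0"
    using \<delta>(1) by (simp add: mult_le_0_iff)
  then have "(norm (Xstar - outer u))\<^sup>2 \<le> 0"
    by (intro order_trans[OF dist_outer_le[OF Xs u]]) simp
  then have eq: "Xstar = outer u" by simp
  show ?thesis
  proof (rule that[OF u eq])
    fix X :: "real^'n^'n" assume X: "X \<in> spectrahedron"
    \<comment> \<open>Squared distance is traded for off-\<open>u\<close> weight, which the eigengap
      bounds by the linear term and convexity by the gap in \<open>f\<close>.\<close>
    have "\<delta> / 2 * (norm (X - Xstar))\<^sup>2 \<le> \<delta> / 2 * (2 * (1 - X \<bullet> outer u))"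
      using dist_outer_le[OF X u] \<delta>(1) unfolding eq by (intro mult_left_mono) auto
    also have "\<dots> \<le> ?G \<bullet> (X - Xstar)"
      using gap[OF X] by (simp add: eq inner_diff_right algebra_simps)
    also have "\<dots> \<le> f X - f Xstar"
      using convex_gradient_inequality[OF conv diff, of Xstar X] subsetD[OF sym X] subsetD[OF sym Xs]
      by linarith
    finally show "\<delta> / 2 * (norm (X - Xstar))\<^sup>2 \<le> f X - f Xstar" .
  qed
qed

text \<open>The minimum with 1 in \<open>step_size\<close> makes every update a convex
  combination.\<close>

lemma regularized_FW_in_spectrahedron:
  assumes "regularized_FW f \<beta> \<delta> X v" "0 \<le> step_size \<beta> \<delta>" "1 \<le> t"
  shows "X t \<in> spectrahedron"
  using assms(3)
proof (induction t rule: dec_induct)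
  case base
  show ?case using assms(1) unfolding regularized_FW_def Let_def by blast
next
  case (step t)
  have eq: "X (Suc t) = (1 - step_size \<beta> \<delta>) *\<^sub>R X t + step_size \<beta> \<delta> *\<^sub>R outer (v t)"
    and "norm (v t) = 1"
    using assms(1) step.hyps(1) unfolding regularized_FW_def Let_def is_arg_min_def Suc_eq_plus1
    by blast+
  show ?case unfolding eq
    using step.IH assms(2) outer_in_spectrahedron[OF \<open>norm (v t) = 1\<close>]
    by (intro convexD[OF convex_spectrahedron]) (auto simp: step_size_def)
qed

theorem theorem5:
  fixes f :: "real^'n^'n \<Rightarrow> real"
    and \<beta> \<delta> fstar :: real
    and Xstar :: "real^'n^'n"
    and X :: "nat \<Rightarrow> real^'n^'n"
    and v :: "nat \<Rightarrow> real^'n"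
  assumes "CARD('n) \<ge> 2"
    and "convex_on sym_matrices f"
    and "\<beta> > 0"
    and "smooth_on_sym \<beta> f"
    and "fstar = (INF Y\<in>spectrahedron. f Y)"
    and "is_arg_min f (\<lambda>Y. Y \<in> spectrahedron) Xstar"
    and "eigval (CARD('n) - 1) (sym_gradient f Xstar) - eigval (CARD('n)) (sym_gradient f Xstar) > 0"
    and "\<delta> \<in> {0 <.. eigval (CARD('n) - 1) (sym_gradient f Xstar)
                    - eigval (CARD('n)) (sym_gradient f Xstar)}"
    and "regularized_FW f \<beta> \<delta> X v"
  shows "\<forall>t\<ge>1. f (X (t + 1)) - fstar
                 \<le> (1 - min (1/2) (\<delta> / (4 * \<beta>))) * (f (X t) - fstar)"
proof (intro allI impI)
  fix t :: nat assume t: "1 \<le> t"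
  have diff: "f differentiable_on sym_matrices"
    using assms(4) by (simp add: smooth_on_sym_def)
  have \<delta>: "0 < \<delta>" using assms(8) by simp
  have Xs: "Xstar \<in> spectrahedron" and minle: "\<And>Y. Y \<in> spectrahedron \<Longrightarrow> f Xstar \<le> f Y"
    using assms(6) by (auto simp: is_arg_min_linorder)
  have fstar: "fstar = f Xstar"
    unfolding assms(5) using Xs minle by (intro cInf_eq_minimum) auto
  obtain u where u: "norm u = 1" "Xstar = outer u"
    and growth: "\<And>X. X \<in> spectrahedron \<Longrightarrow> \<delta> / 2 * (norm (X - Xstar))\<^sup>2 \<le> f X - f Xstar"
    using quadratic_growth[OF assms(1,2) diff assms(6) \<delta>] assms(8) by auto
  define \<eta> where "\<eta> = step_size \<beta> \<delta>"
  have \<eta>: "0 < \<eta>" "\<eta> * \<beta> \<le> \<delta> / 2"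
    using \<delta> assms(3) by (auto simp: \<eta>_def step_size_def min_def field_simps)
  have Xt: "X t \<in> spectrahedron"
    using regularized_FW_in_spectrahedron[OF assms(9) _ t] \<eta>(1) by (simp add: \<eta>_def)
  let ?g = "sym_gradient f (X t)"
  let ?h = "f (X t) - fstar"
  have am: "is_arg_min (\<lambda>w. outer w \<bullet> ?g + \<eta> * \<beta> / 2 * (norm (outer w - X t))\<^sup>2) (\<lambda>w. norm w = 1) (v t)"
    and next_iterate: "X (t + 1) = (1 - \<eta>) *\<^sub>R X t + \<eta> *\<^sub>R outer (v t)"
    using assms(9) t unfolding regularized_FW_def Let_def \<eta>_def by blast+
  \<comment> \<open>The comparison with \<open>Xstar\<close> is legitimate because
    \<open>Xstar = outer u\<close> with \<open>u\<close> a unit vector, hence feasible in the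
    subproblem.\<close>
  have v: "norm (v t) = 1"
    "outer (v t) \<bullet> ?g + \<eta> * \<beta> / 2 * (norm (outer (v t) - X t))\<^sup>2
       \<le> Xstar \<bullet> ?g + \<eta> * \<beta> / 2 * (norm (Xstar - X t))\<^sup>2"
    using am u by (auto simp: is_arg_min_linorder)
  have sym: "X t \<in> sym_matrices" "Xstar \<in> sym_matrices" "outer (v t) \<in> sym_matrices"
    using Xt Xs outer_in_spectrahedron[OF v(1)] by (auto simp: spectrahedron_def)
  have h: "\<delta> / 2 * (norm (Xstar - X t))\<^sup>2 \<le> ?h" "?g \<bullet> (Xstar - X t) \<le> - ?h"
    using growth[OF Xt] convex_gradient_inequality[OF assms(2) diff sym(1,2)]
    by (auto simp: fstar norm_minus_commute)
  define D where "D = outer (v t) - X t"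
  have gD: "?g \<bullet> D = outer (v t) \<bullet> ?g - X t \<bullet> ?g"
    by (simp add: D_def inner_diff_right inner_commute)
  have "f (X (t + 1)) = f (X t + \<eta> *\<^sub>R D)"
    unfolding next_iterate D_def by (simp add: algebra_simps)
  also have "\<dots> \<le> f (X t) + ?g \<bullet> (\<eta> *\<^sub>R D) + \<beta> / 2 * (norm (\<eta> *\<^sub>R D))\<^sup>2"
    using sym unfolding D_def by (intro smooth_upper_bound[OF assms(4)])
      (auto intro!: subspace_diff subspace_scale subspace_sym_matrices)
  \<comment> \<open>Pulling out one factor \<open>\<eta>\<close> leaves exactly the objective
    minimised by \<open>v t\<close>; this is why its regularisation weight is
    \<open>\<eta> * \<beta> / 2\<close>.\<close>
  also have "\<dots> = f (X t) - \<eta> * (X t \<bullet> ?g)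
      + \<eta> * (outer (v t) \<bullet> ?g + \<eta> * \<beta> / 2 * (norm (outer (v t) - X t))\<^sup>2)"
    by (simp add: gD power_mult_distrib algebra_simps power2_eq_square flip: D_def)
  also have "\<dots> \<le> f (X t) - \<eta> * (X t \<bullet> ?g)
      + \<eta> * (Xstar \<bullet> ?g + \<eta> * \<beta> / 2 * (norm (Xstar - X t))\<^sup>2)"
    using v(2) \<eta>(1) by (intro add_left_mono mult_left_mono) auto
  also have "\<dots> = f (X t) + \<eta> * (?g \<bullet> (Xstar - X t) + \<eta> * \<beta> / 2 * (norm (Xstar - X t))\<^sup>2)"
    by (simp add: inner_diff_right inner_commute algebra_simps)
  \<comment> \<open>Convexity supplies \<open>- ?h\<close>; the step-size bound and quadratic growth
    limit the regularisation cost to \<open>?h / 2\<close>, so half of the decrease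
    survives.\<close>
  also have "\<dots> \<le> f (X t) + \<eta> * (- ?h + ?h / 2)"
  proof -
    have "\<eta> * \<beta> / 2 * (norm (Xstar - X t))\<^sup>2 \<le> (\<delta> / 2) / 2 * (norm (Xstar - X t))\<^sup>2"
      using \<eta>(2) by (intro mult_right_mono) (auto simp: mult.commute)
    also have "\<dots> \<le> ?h / 2" using h(1) by simp
    finally show ?thesis using h(2) \<eta>(1) by (intro add_left_mono mult_left_mono add_mono) auto
  qed
  finally have "f (X (t + 1)) - fstar \<le> (1 - \<eta> / 2) * ?h"
    by (simp add: field_simps)
  moreover have "\<eta> / 2 = min (1/2) (\<delta> / (4 * \<beta>))"
    by (simp add: \<eta>_def step_size_def min_def)
  ultimately show "f (X (t + 1)) - fstar \<le> (1 - min (1/2) (\<delta> / (4 * \<beta>))) * ?h"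
    by simp
qed

end
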